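(* Let $R$ be a noetherian commutative ring with identity. Then $R$ is an MTL-ring if and only if for every maximal ideal $M$ of $R$ the ideals of the localization $R_M$ are totally ordered by set inclusion.
   Context: For ideals $I,J$ of a commutative ring $R$, write $I\rightarrow J=\{x\in R : xI\subseteq J\}$. A commutative ring $R$ such that for every $x\in R$ there is $r\in R$ with $x=rx$ (automatic if $R$ has an identity) is called an MTL-ring if $(I\rightarrow J)+(J\rightarrow I)=R$ for all ideals $I,J$ of $R$. *)

theory Defs
  imports "HOL-Algebra.Algebra"
begin

definition ideal_residual :: "('a, 'm) ring_scheme \<Rightarrow> 'a set \<Rightarrow> 'a set \<Rightarrow> 'a set"
  where "ideal_residual R I J = {x \<in> carrier R. \<forall>a\<in>I. x \<otimes>\<^bsub>R\<^esub> a \<in> J}"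

text \<open>
  Rings of \<^theory>\<open>HOL-Algebra.Ring\<close> have an identity, so \<open>factor_exists\<close> holds automatically here;
  it is kept because it belongs to the definition of an MTL-ring, which also covers commutative
  rings without identity.
\<close>
locale MTL_ring = cring +
  assumes factor_exists: "x \<in> carrier R \<Longrightarrow> \<exists>r\<in>carrier R. x = r \<otimes> x"
    and residual_sum:
      "\<lbrakk>ideal I R; ideal J R\<rbrakk> \<Longrightarrow> ideal_residual R I J <+>\<^bsub>R\<^esub> ideal_residual R J I = carrier R"

text \<open>
  The ring of fractions \<open>S\<^sup>-\<^sup>1 R\<close>: a fraction is a class of pairs \<open>(a, s)\<close>, where \<open>(a, s)\<close> and
  \<open>(b, t)\<close> are identified when \<open>u (a t - b s) = 0\<close> for some \<open>u \<in> S\<close>. The factor \<open>u\<close> is needed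
  since \<open>R\<close> may have zero divisors. The operations collect the results over all representatives,
  which is a single class when \<open>S\<close> is multiplicatively closed and contains \<open>\<one>\<close>.
\<close>
definition fraction_rel ::
  "('a, 'm) ring_scheme \<Rightarrow> 'a set \<Rightarrow> (('a \<times> 'a) \<times> ('a \<times> 'a)) set"
  where "fraction_rel R S =
    {((a, s), (b, t)). a \<in> carrier R \<and> s \<in> S \<and> b \<in> carrier R \<and> t \<in> S \<and>
       (\<exists>u\<in>S. u \<otimes>\<^bsub>R\<^esub> (a \<otimes>\<^bsub>R\<^esub> t \<ominus>\<^bsub>R\<^esub> b \<otimes>\<^bsub>R\<^esub> s) = \<zero>\<^bsub>R\<^esub>)}"

definition ring_of_fractions ::
  "('a, 'm) ring_scheme \<Rightarrow> 'a set \<Rightarrow> ('a \<times> 'a) set ring"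
  where "ring_of_fractions R S =
    \<lparr>carrier = (carrier R \<times> S) // fraction_rel R S,
     monoid.mult = (\<lambda>A B. \<Union>(a, s)\<in>A. \<Union>(b, t)\<in>B.
        fraction_rel R S `` {(a \<otimes>\<^bsub>R\<^esub> b, s \<otimes>\<^bsub>R\<^esub> t)}),
     one = fraction_rel R S `` {(\<one>\<^bsub>R\<^esub>, \<one>\<^bsub>R\<^esub>)},
     ring.zero = fraction_rel R S `` {(\<zero>\<^bsub>R\<^esub>, \<one>\<^bsub>R\<^esub>)},
     ring.add = (\<lambda>A B. \<Union>(a, s)\<in>A. \<Union>(b, t)\<in>B.
        fraction_rel R S `` {(a \<otimes>\<^bsub>R\<^esub> t \<oplus>\<^bsub>R\<^esub> b \<otimes>\<^bsub>R\<^esub> s, s \<otimes>\<^bsub>R\<^esub> t)})\<rparr>"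

definition localization_at :: "('a, 'm) ring_scheme \<Rightarrow> 'a set \<Rightarrow> ('a \<times> 'a) set ring"
  where "localization_at R P = ring_of_fractions R (carrier R - P)"

locale mult_subset = cring R + submonoid S R for R (structure) and S
begin

abbreviation frac where "frac a s \<equiv> fraction_rel R S `` {(a, s)}"
abbreviation Q where "Q \<equiv> ring_of_fractions R S"

lemma S_carr [simp]: "s \<in> S \<Longrightarrow> s \<in> carrier R"
  using subset by blast

lemma fraction_rel_iff:
  "((a, s), (b, t)) \<in> fraction_rel R S \<longleftrightarrow>
    a \<in> carrier R \<and> s \<in> S \<and> b \<in> carrier R \<and> t \<in> S \<and>
      (\<exists>u\<in>S. u \<otimes> (a \<otimes> t) = u \<otimes> (b \<otimes> s))"
proof -
  have "u \<otimes> (a \<otimes> t \<ominus> b \<otimes> s) = \<zero> \<longleftrightarrow> u \<otimes> (a \<otimes> t) = u \<otimes> (b \<otimes> s)"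
    if "u \<in> S" "a \<in> carrier R" "s \<in> S" "b \<in> carrier R" "t \<in> S" for u
  proof -
    have "u \<otimes> (a \<otimes> t \<ominus> b \<otimes> s) = u \<otimes> (a \<otimes> t) \<ominus> u \<otimes> (b \<otimes> s)"
      using that by (simp add: minus_eq r_distr r_minus)
    then show ?thesis
      using that by simp
  qed
  then show ?thesis
    by (auto simp: fraction_rel_def)
qed

lemma equiv_fraction_rel: "equiv (carrier R \<times> S) (fraction_rel R S)"
proof (rule equivI)
  show "fraction_rel R S \<subseteq> (carrier R \<times> S) \<times> carrier R \<times> S"
    by (auto simp: fraction_rel_def)
  show "refl_on (carrier R \<times> S) (fraction_rel R S)"
    using one_closed by (auto simp: refl_on_def fraction_rel_iff)
  show "sym (fraction_rel R S)"
    by (rule symI) (force simp: fraction_rel_iff)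
  show "trans (fraction_rel R S)"
  proof (rule transI, clarify)
    fix a s b t c v
    assume "((a, s), (b, t)) \<in> fraction_rel R S" "((b, t), (c, v)) \<in> fraction_rel R S"
    then obtain u w where c: "a \<in> carrier R" "b \<in> carrier R" "c \<in> carrier R"
        "s \<in> S" "t \<in> S" "v \<in> S" "u \<in> S" "w \<in> S"
      and 1: "u \<otimes> (a \<otimes> t) = u \<otimes> (b \<otimes> s)" and 2: "w \<otimes> (b \<otimes> v) = w \<otimes> (c \<otimes> t)"
      by (auto simp: fraction_rel_iff)
    have "(u \<otimes> w \<otimes> t) \<otimes> (a \<otimes> v) = (w \<otimes> v) \<otimes> (u \<otimes> (a \<otimes> t))"
      using c by (simp add: m_ac)
    also have "\<dots> = (u \<otimes> s) \<otimes> (w \<otimes> (b \<otimes> v))"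
      unfolding 1 using c by (simp add: m_ac)
    also have "\<dots> = (u \<otimes> w \<otimes> t) \<otimes> (c \<otimes> s)"
      unfolding 2 using c by (simp add: m_ac)
    finally show "((a, s), (c, v)) \<in> fraction_rel R S"
      using c by (auto simp: fraction_rel_iff intro!: bexI[of _ "u \<otimes> w \<otimes> t"])
  qed
qed

lemma frac_eq_iff:
  assumes "a \<in> carrier R" "s \<in> S" "b \<in> carrier R" "t \<in> S"
  shows "frac a s = frac b t \<longleftrightarrow> (\<exists>u\<in>S. u \<otimes> (a \<otimes> t) = u \<otimes> (b \<otimes> s))"
  using eq_equiv_class_iff[OF equiv_fraction_rel, of "(a, s)" "(b, t)"] assms
  by (auto simp: fraction_rel_iff)

lemma frac_closed [simp]: "a \<in> carrier R \<Longrightarrow> s \<in> S \<Longrightarrow> frac a s \<in> carrier Q"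
  by (simp add: ring_of_fractions_def quotientI)

lemma frac_cases:
  assumes "x \<in> carrier Q"
  obtains a s where "a \<in> carrier R" "s \<in> S" "x = frac a s"
  using assms by (auto simp: ring_of_fractions_def elim!: quotientE)

lemma frac_mult:
  assumes "a \<in> carrier R" "s \<in> S" "b \<in> carrier R" "t \<in> S"
  shows "frac a s \<otimes>\<^bsub>Q\<^esub> frac b t = frac (a \<otimes> b) (s \<otimes> t)"
proof -
  have "frac (a' \<otimes> b') (s' \<otimes> t') = frac (a \<otimes> b) (s \<otimes> t)"
    if 1: "((a, s), (a', s')) \<in> fraction_rel R S" and 2: "((b, t), (b', t')) \<in> fraction_rel R S"
    for a' s' b' t'
  proof -
    obtain u w where c: "a' \<in> carrier R" "b' \<in> carrier R" "s' \<in> S" "t' \<in> S" "u \<in> S" "w \<in> S"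
      and e: "u \<otimes> (a \<otimes> s') = u \<otimes> (a' \<otimes> s)" "w \<otimes> (b \<otimes> t') = w \<otimes> (b' \<otimes> t)"
      using 1 2 by (auto simp: fraction_rel_iff)
    have "(u \<otimes> w) \<otimes> ((a' \<otimes> b') \<otimes> (s \<otimes> t)) = (u \<otimes> (a' \<otimes> s)) \<otimes> (w \<otimes> (b' \<otimes> t))"
      using c assms by (simp add: m_ac)
    also have "\<dots> = (u \<otimes> w) \<otimes> ((a \<otimes> b) \<otimes> (s' \<otimes> t'))"
      unfolding e[symmetric] using c assms by (simp add: m_ac)
    finally show ?thesis
      using c assms by (subst frac_eq_iff) (auto intro!: bexI[of _ "u \<otimes> w"])
  qed
  moreover have "(a, s) \<in> frac a s" "(b, t) \<in> frac b t"
    using equiv_class_self[OF equiv_fraction_rel] assms by auto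
  ultimately show ?thesis
    unfolding ring_of_fractions_def monoid.simps by (fastforce intro!: equalityI)
qed

lemma frac_add:
  assumes "a \<in> carrier R" "s \<in> S" "b \<in> carrier R" "t \<in> S"
  shows "frac a s \<oplus>\<^bsub>Q\<^esub> frac b t = frac (a \<otimes> t \<oplus> b \<otimes> s) (s \<otimes> t)"
proof -
  have "frac (a' \<otimes> t' \<oplus> b' \<otimes> s') (s' \<otimes> t') = frac (a \<otimes> t \<oplus> b \<otimes> s) (s \<otimes> t)"
    if 1: "((a, s), (a', s')) \<in> fraction_rel R S" and 2: "((b, t), (b', t')) \<in> fraction_rel R S"
    for a' s' b' t'
  proof -
    obtain u w where c: "a' \<in> carrier R" "b' \<in> carrier R" "s' \<in> S" "t' \<in> S" "u \<in> S" "w \<in> S"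
      and e: "u \<otimes> (a \<otimes> s') = u \<otimes> (a' \<otimes> s)" "w \<otimes> (b \<otimes> t') = w \<otimes> (b' \<otimes> t)"
      using 1 2 by (auto simp: fraction_rel_iff)
    have "(u \<otimes> w) \<otimes> ((a' \<otimes> t' \<oplus> b' \<otimes> s') \<otimes> (s \<otimes> t)) =
        (w \<otimes> t \<otimes> t') \<otimes> (u \<otimes> (a' \<otimes> s)) \<oplus> (u \<otimes> s \<otimes> s') \<otimes> (w \<otimes> (b' \<otimes> t))"
      using c assms by (simp add: m_ac l_distr r_distr)
    also have "\<dots> = (u \<otimes> w) \<otimes> ((a \<otimes> t \<oplus> b \<otimes> s) \<otimes> (s' \<otimes> t'))"
      unfolding e[symmetric] using c assms by (simp add: m_ac l_distr r_distr)
    finally show ?thesis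
      using c assms by (subst frac_eq_iff) (auto intro!: bexI[of _ "u \<otimes> w"])
  qed
  moreover have "(a, s) \<in> frac a s" "(b, t) \<in> frac b t"
    using equiv_class_self[OF equiv_fraction_rel] assms by auto
  ultimately show ?thesis
    unfolding ring_of_fractions_def ring.simps by (fastforce intro!: equalityI)
qed

lemma frac_eqI:
  assumes "a \<in> carrier R" "s \<in> S" "b \<in> carrier R" "t \<in> S" "a \<otimes> t = b \<otimes> s"
  shows "frac a s = frac b t"
  using assms one_closed by (auto simp: frac_eq_iff)

lemma one_frac: "\<one>\<^bsub>Q\<^esub> = frac \<one> \<one>" and zero_frac: "\<zero>\<^bsub>Q\<^esub> = frac \<zero> \<one>"
  by (simp_all add: ring_of_fractions_def)

lemma cring_ring_of_fractions: "cring Q"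
proof (rule cringI)
  note [simp] = frac_mult frac_add one_frac zero_frac
  show "abelian_group Q"
  proof (rule abelian_groupI)
    fix x assume "x \<in> carrier Q"
    then obtain a s where x: "a \<in> carrier R" "s \<in> S" "x = frac a s" by (rule frac_cases)
    then have "frac (\<ominus> a) s \<oplus>\<^bsub>Q\<^esub> x = frac \<zero> (s \<otimes> s)"
      by (simp add: l_minus l_neg)
    also have "\<dots> = frac \<zero> \<one>"
      using x one_closed by (intro frac_eqI) auto
    finally have "frac (\<ominus> a) s \<oplus>\<^bsub>Q\<^esub> x = \<zero>\<^bsub>Q\<^esub>"
      by simp
    then show "\<exists>y\<in>carrier Q. y \<oplus>\<^bsub>Q\<^esub> x = \<zero>\<^bsub>Q\<^esub>"
      using x by (blast intro: frac_closed a_inv_closed)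
  qed (use one_closed in \<open>auto elim!: frac_cases intro!: frac_eqI simp: m_ac a_ac l_distr r_distr\<close>)
  show "comm_monoid Q"
    by (rule comm_monoidI)
      (use one_closed in \<open>auto elim!: frac_cases intro!: frac_eqI simp: m_ac\<close>)
  fix x y z assume "x \<in> carrier Q" "y \<in> carrier Q" "z \<in> carrier Q"
  then obtain a s b t c v where c: "a \<in> carrier R" "b \<in> carrier R" "c \<in> carrier R"
      "s \<in> S" "t \<in> S" "v \<in> S" and e: "x = frac a s" "y = frac b t" "z = frac c v"
    by (metis frac_cases)
  have "frac ((a \<otimes> t \<oplus> b \<otimes> s) \<otimes> c) (s \<otimes> t \<otimes> v) =
      frac (a \<otimes> c \<otimes> (t \<otimes> v) \<oplus> b \<otimes> c \<otimes> (s \<otimes> v)) (s \<otimes> v \<otimes> (t \<otimes> v))"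
    using c by (intro frac_eqI) (simp_all add: m_ac l_distr r_distr)
  then show "(x \<oplus>\<^bsub>Q\<^esub> y) \<otimes>\<^bsub>Q\<^esub> z = x \<otimes>\<^bsub>Q\<^esub> z \<oplus>\<^bsub>Q\<^esub> y \<otimes>\<^bsub>Q\<^esub> z"
    using c by (simp add: e)
qed

end

lemma cring_localization_at:
  fixes R (structure)
  assumes "primeideal P R"
  shows "cring (localization_at R P)"
proof -
  interpret primeideal P R by fact
  have "submonoid (carrier R - P) R"
    using I_prime I_notcarr one_imp_carrier by unfold_locales auto
  then interpret mult_subset R "carrier R - P"
    by (simp add: mult_subset_def is_cring)
  show ?thesis
    unfolding localization_at_def by (rule cring_ring_of_fractions)
qed

end

theory Submission
  imports Defs
begin

text \<open>
  If \<open>p + q = 1\<close> with \<open>p a \<in> (b)\<close> and \<open>q b \<in> (a)\<close>, one of \<open>p\<close>, \<open>q\<close> is a unit in \<open>R\<^sub>M\<close>, so any two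
  elements of \<open>R\<^sub>M\<close> are comparable for divisibility and its ideals form a chain. Conversely, if
  \<open>(I \<rightarrow> J) + (J \<rightarrow> I)\<close> is proper, it lies in a maximal ideal \<open>M\<close>. Comparing the extensions of \<open>I\<close> and
  \<open>J\<close> to \<open>R\<^sub>M\<close> and clearing the denominators of finitely many generators produces an element outside
  \<open>M\<close> that lies in \<open>I \<rightarrow> J\<close> or in \<open>J \<rightarrow> I\<close>.
\<close>

section \<open>Ideals of commutative and noetherian rings\<close>

lemma (in cring) idealI':
  assumes "I \<subseteq> carrier R" "\<zero> \<in> I"
    and add: "\<And>a b. a \<in> I \<Longrightarrow> b \<in> I \<Longrightarrow> a \<oplus> b \<in> I"
    and mult: "\<And>x a. x \<in> carrier R \<Longrightarrow> a \<in> I \<Longrightarrow> x \<otimes> a \<in> I"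
  shows "ideal I R"
proof (rule idealI)
  show "subgroup I (add_monoid R)"
  proof (rule add.subgroupI)
    fix a assume a: "a \<in> I"
    \<comment> \<open>Closure under negation follows from closure under multiplication by
      \<open>\<ominus> \<one>\<close>.\<close>
    then have "\<ominus> a = (\<ominus> \<one>) \<otimes> a"
      using assms(1) by (auto simp: l_minus)
    then show "\<ominus> a \<in> I"
      using mult[of "\<ominus> \<one>" a] a by simp
  qed (use assms in auto)
  show "a \<otimes> x \<in> I" if "a \<in> I" "x \<in> carrier R" for a x
    using mult[OF that(2,1)] that assms(1) by (simp add: m_comm subset_iff)
qed (use assms ring_axioms in auto)

lemma (in cring) ideal_ideal_residual:
  assumes "ideal I R" "ideal J R"
  shows "ideal (ideal_residual R I J) R"
proof -
  interpret I: ideal I R by fact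
  interpret J: ideal J R by fact
  show ?thesis
    by (rule idealI') (auto simp: ideal_residual_def l_distr m_assoc J.I_l_closed)
qed

text \<open>Zorn's lemma on the proper ideals that contain \<open>I\<close>. The ascending chain
  condition supplies the upper bounds: the union of a nonempty chain of ideals is itself a member of
  the chain, hence proper.\<close>

lemma (in noetherian_ring) ideal_subset_maximalideal:
  assumes "ideal I R" "I \<noteq> carrier R"
  obtains M where "maximalideal M R" "I \<subseteq> M"
proof -
  define A where "A = {J. ideal J R \<and> I \<subseteq> J \<and> J \<noteq> carrier R}"
  have "\<Union>C \<in> A" if "C \<noteq> {}" "subset.chain A C" for C
  proof -
    have "subset.chain {J. ideal J R} C"
      using that by (auto simp: A_def pred_on.chain_def)
    then have "\<Union>C \<in> C"
      by (rule ideal_chain_is_trivial[OF that(1)])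
    then show ?thesis
      using that(2) unfolding pred_on.chain_def by blast
  qed
  moreover have "A \<noteq> {}"
    using assms by (auto simp: A_def)
  ultimately obtain M where M: "M \<in> A" "\<And>J. J \<in> A \<Longrightarrow> M \<subseteq> J \<Longrightarrow> J = M"
    using subset_Zorn_nonempty[of A] by metis
  have "maximalideal M R"
    using M by (intro maximalidealI) (auto simp: A_def)
  then show ?thesis
    using M that by (auto simp: A_def)
qed

section \<open>Ideals of \<open>R\<close> and ideals of the ring of fractions\<close>

context mult_subset
begin

text \<open>Adding over the common denominator \<open>s \<otimes> t\<close> keeps the numerator in
  \<open>I\<close>, so the fractions with numerator in \<open>I\<close> already make up the
  extension of \<open>I\<close>, without passing to generated sums.\<close>

lemma ideal_frac:
  assumes "ideal I R"
  shows "ideal {frac a s | a s. a \<in> I \<and> s \<in> S} Q" (is "ideal ?E Q")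
proof -
  interpret I: ideal I R by fact
  interpret Q: cring Q by (rule cring_ring_of_fractions)
  show ?thesis
  proof (rule Q.idealI')
    show "?E \<subseteq> carrier Q"
      by (auto simp: I.Icarr)
    show "\<zero>\<^bsub>Q\<^esub> \<in> ?E"
      unfolding zero_frac using one_closed I.zero_closed by blast
    show "x \<oplus>\<^bsub>Q\<^esub> y \<in> ?E" if x: "x \<in> ?E" and y: "y \<in> ?E" for x y
    proof -
      obtain a s b t where *: "a \<in> I" "s \<in> S" "b \<in> I" "t \<in> S" "x = frac a s" "y = frac b t"
        using x y by blast
      then have "x \<oplus>\<^bsub>Q\<^esub> y = frac (a \<otimes> t \<oplus> b \<otimes> s) (s \<otimes> t)"
        by (simp add: frac_add I.Icarr)
      moreover have "a \<otimes> t \<oplus> b \<otimes> s \<in> I"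
        using * by (simp add: I.I_r_closed)
      ultimately show ?thesis
        using * by blast
    qed
    show "x \<otimes>\<^bsub>Q\<^esub> y \<in> ?E" if x: "x \<in> carrier Q" and y: "y \<in> ?E" for x y
    proof -
      obtain a s where a: "a \<in> carrier R" "s \<in> S" "x = frac a s"
        using x by (rule frac_cases)
      obtain b t where b: "b \<in> I" "t \<in> S" "y = frac b t"
        using y by blast
      have "x \<otimes>\<^bsub>Q\<^esub> y = frac (a \<otimes> b) (s \<otimes> t)"
        using a b by (simp add: frac_mult I.Icarr)
      moreover have "a \<otimes> b \<in> I"
        using a b by (simp add: I.I_l_closed)
      ultimately show ?thesis
        using a b by blast
    qed
  qed
qed

text \<open>If \<open>a/1 = b/s\<close>, then
  \<open>u \<otimes> s \<otimes> a = u \<otimes> b\<close> for some \<open>u \<in> S\<close>, so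
  \<open>u \<otimes> s\<close> multiplies \<open>a\<close> into \<open>J\<close>.\<close>

lemma denominator_exists:
  assumes "ideal J R" "a \<in> carrier R"
    and "frac a \<one> \<in> {frac b s | b s. b \<in> J \<and> s \<in> S}"
  shows "\<exists>u\<in>S. u \<otimes> a \<in> J"
proof -
  interpret J: ideal J R by fact
  obtain b s where b: "b \<in> J" "s \<in> S" "frac a \<one> = frac b s"
    using assms(3) by blast
  then obtain u where u: "u \<in> S" "u \<otimes> (a \<otimes> s) = u \<otimes> (b \<otimes> \<one>)"
    using assms(2) one_closed frac_eq_iff[of a \<one> b s] J.Icarr by blast
  have "(u \<otimes> s) \<otimes> a = u \<otimes> (a \<otimes> s)"
    using u b assms(2) by (simp add: m_ac)
  also have "\<dots> \<in> J"
    unfolding u(2) using u b by (simp add: J.Icarr J.I_l_closed)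
  finally show ?thesis
    using u b by blast
qed

text \<open>The product of the finitely many multipliers works for all elements at once.\<close>

lemma common_denominator_exists:
  assumes "ideal J R" "finite A" "A \<subseteq> carrier R" "\<And>a. a \<in> A \<Longrightarrow> \<exists>u\<in>S. u \<otimes> a \<in> J"
  shows "\<exists>u\<in>S. \<forall>a\<in>A. u \<otimes> a \<in> J"
  using assms(2-)
proof (induction A)
  case empty
  then show ?case using one_closed by blast
next
  case (insert a A)
  interpret J: ideal J R by fact
  obtain u v where uv: "u \<in> S" "v \<in> S" "u \<otimes> a \<in> J" "\<forall>x\<in>A. v \<otimes> x \<in> J"
    using insert by fastforce
  have "(u \<otimes> v) \<otimes> x \<in> J" if "x \<in> insert a A" for x
  proof -
    have x: "x \<in> carrier R"
      using that insert.prems by auto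
    \<comment> \<open>The first form serves \<open>x = a\<close>, the second
      \<open>x \<in> A\<close>.\<close>
    have "(u \<otimes> v) \<otimes> x = v \<otimes> (u \<otimes> x)" "(u \<otimes> v) \<otimes> x = u \<otimes> (v \<otimes> x)"
      using uv x by (simp_all add: m_ac)
    then show ?thesis
      using that uv J.I_l_closed by (metis S_carr insertE)
  qed
  then show ?case
    using uv by blast
qed

text \<open>Each generator \<open>a\<close> of \<open>I\<close> gives a fraction \<open>a/1\<close>
  in the extension of \<open>J\<close>. A common multiplier \<open>u \<in> S\<close> for a finite
  generating set is the required element of the residual.\<close>

lemma residual_meets_denominators:
  assumes "noetherian_ring R" "ideal I R" "ideal J R"
    and "{frac a s | a s. a \<in> I \<and> s \<in> S} \<subseteq> {frac a s | a s. a \<in> J \<and> s \<in> S}"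
  shows "ideal_residual R I J \<inter> S \<noteq> {}"
proof -
  interpret J: ideal J R by fact
  obtain A where A: "A \<subseteq> carrier R" "finite A" "I = Idl A"
    using noetherian_ring.finetely_gen[OF assms(1,2)] by auto
  have "A \<subseteq> I"
    using A genideal_self by simp
  then have "\<exists>u\<in>S. u \<otimes> a \<in> J" if "a \<in> A" for a
    using that A assms(4) one_closed by (intro denominator_exists[OF assms(3)]) blast+
  then obtain u where u: "u \<in> S" "\<forall>a\<in>A. u \<otimes> a \<in> J"
    using common_denominator_exists[OF assms(3) A(2,1)] by blast
  \<comment> \<open>The elements that \<open>u\<close> multiplies into \<open>J\<close> form an
    ideal, so containing the generators \<open>A\<close> it contains all of
    \<open>I\<close>.\<close>
  have "ideal {x \<in> carrier R. u \<otimes> x \<in> J} R"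
  proof (rule idealI')
    show "x \<otimes> a \<in> {x \<in> carrier R. u \<otimes> x \<in> J}"
      if "x \<in> carrier R" "a \<in> {x \<in> carrier R. u \<otimes> x \<in> J}" for x a
      using that u J.I_l_closed[of "u \<otimes> a" x] by (simp add: m_lcomm)
  qed (use u in \<open>auto simp: r_distr\<close>)
  then have "I \<subseteq> {x \<in> carrier R. u \<otimes> x \<in> J}"
    unfolding A(3) by (rule genideal_minimal) (use A u in auto)
  then have "u \<in> ideal_residual R I J"
    using u by (auto simp: ideal_residual_def)
  then show ?thesis
    using u by blast
qed

text \<open>Since \<open>u\<close> becomes a unit, \<open>u \<otimes> a = r \<otimes> b\<close>
  makes \<open>a/s\<close> the multiple of \<open>b/t\<close> by
  \<open>(r \<otimes> t)/(u \<otimes> s)\<close>.\<close>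

lemma frac_mem_ideal:
  assumes "ideal J Q" "frac b t \<in> J"
    and "a \<in> carrier R" "s \<in> S" "b \<in> carrier R" "t \<in> S" "u \<in> S" "u \<otimes> a \<in> PIdl b"
  shows "frac a s \<in> J"
proof -
  interpret J: ideal J Q by fact
  obtain r where r: "r \<in> carrier R" "u \<otimes> a = r \<otimes> b"
    using assms(8) by (auto simp: cgenideal_def)
  have "frac a s = frac ((r \<otimes> t) \<otimes> b) ((u \<otimes> s) \<otimes> t)"
  proof (rule frac_eqI)
    have "a \<otimes> ((u \<otimes> s) \<otimes> t) = (u \<otimes> a) \<otimes> (s \<otimes> t)"
      using assms by (simp add: m_ac)
    also have "\<dots> = ((r \<otimes> t) \<otimes> b) \<otimes> s"
      unfolding r(2) using assms r by (simp add: m_ac)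
    finally show "a \<otimes> ((u \<otimes> s) \<otimes> t) = ((r \<otimes> t) \<otimes> b) \<otimes> s" .
  qed (use assms r in auto)
  also have "\<dots> = frac (r \<otimes> t) (u \<otimes> s) \<otimes>\<^bsub>Q\<^esub> frac b t"
    using assms r by (simp add: frac_mult)
  also have "\<dots> \<in> J"
    using assms r by (intro J.I_l_closed) auto
  finally show ?thesis .
qed

end

section \<open>Localization at a maximal ideal and the two implications\<close>

lemma mult_subset_maximalideal:
  fixes R (structure)
  assumes "cring R" "maximalideal M R"
  shows "mult_subset R (carrier R - M)"
proof -
  interpret cring R by fact
  interpret primeideal M R
    using assms(2) by (rule maximalideal_prime)
  have "submonoid (carrier R - M) R"
    using I_prime I_notcarr one_imp_carrier by unfold_locales auto
  then show ?thesis
    by (simp add: mult_subset_def is_cring)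
qed

lemma (in MTL_ring) ideals_localization_chain:
  assumes "maximalideal M R"
    and "ideal I (localization_at R M)" "ideal J (localization_at R M)"
  shows "I \<subseteq> J \<or> J \<subseteq> I"
proof (rule ccontr)
  interpret mult_subset R "carrier R - M"
    using is_cring assms(1) by (rule mult_subset_maximalideal)
  note S_carr [simp del] \<comment> \<open>for \<open>S = carrier R - M\<close> its premise rewrites to itself\<close>
  interpret M: maximalideal M R by fact
  note I = assms(2)[unfolded localization_at_def] and J = assms(3)[unfolded localization_at_def]
  interpret I: ideal I Q by (rule I)
  interpret J: ideal J Q by (rule J)
  assume "\<not> (I \<subseteq> J \<or> J \<subseteq> I)"
  then obtain x y where xy: "x \<in> I" "x \<notin> J" "y \<in> J" "y \<notin> I"
    by blast
  obtain a s where a: "a \<in> carrier R" "s \<in> carrier R - M" "x = frac a s"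
    using I.Icarr[OF xy(1)] by (rule frac_cases)
  obtain b t where b: "b \<in> carrier R" "t \<in> carrier R - M" "y = frac b t"
    using J.Icarr[OF xy(3)] by (rule frac_cases)
  \<comment> \<open>The residual condition is applied in \<open>R\<close> to the principal ideals of
    the two numerators.\<close>
  have "\<one> \<in> ideal_residual R (PIdl a) (PIdl b) <+>\<^bsub>R\<^esub> ideal_residual R (PIdl b) (PIdl a)"
    using residual_sum[OF cgenideal_ideal[OF a(1)] cgenideal_ideal[OF b(1)]] by simp
  then obtain p q where
    pq: "p \<in> ideal_residual R (PIdl a) (PIdl b)" "q \<in> ideal_residual R (PIdl b) (PIdl a)"
      "\<one> = p \<oplus> q"
    unfolding set_add_def' by blast
  have p: "p \<in> carrier R" "p \<otimes> a \<in> PIdl b" and q: "q \<in> carrier R" "q \<otimes> b \<in> PIdl a"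
    using pq(1,2) cgenideal_self[OF a(1)] cgenideal_self[OF b(1)] by (auto simp: ideal_residual_def)
  have "p \<notin> M \<or> q \<notin> M"
    using pq(3) M.a_closed M.one_imp_carrier M.I_notcarr by metis
  then show False
  proof
    assume "p \<notin> M"
    then have "x \<in> J"
      using frac_mem_ideal[OF J, of b t a s p] xy a b p by auto
    with xy show False by simp
  next
    assume "q \<notin> M"
    then have "y \<in> I"
      using frac_mem_ideal[OF I, of a s b t q] xy a b q by auto
    with xy show False by simp
  qed
qed

lemma MTL_ring_if_localizations_chain:
  fixes R (structure)
  assumes "cring R" "noetherian_ring R"
    and chain: "\<And>M I J. \<lbrakk>maximalideal M R; ideal I (localization_at R M);
      ideal J (localization_at R M)\<rbrakk> \<Longrightarrow> I \<subseteq> J \<or> J \<subseteq> I"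
  shows "MTL_ring R"
proof -
  interpret cring R by fact
  interpret noetherian_ring R by fact
  show ?thesis
  proof unfold_locales
    show "\<exists>r\<in>carrier R. x = r \<otimes> x" if "x \<in> carrier R" for x
      using that by (intro bexI[of _ \<one>]) auto
    fix I J assume I: "ideal I R" and J: "ideal J R"
    let ?IJ = "ideal_residual R I J" and ?JI = "ideal_residual R J I"
    have IJ: "ideal ?IJ R" and JI: "ideal ?JI R"
      using I J by (auto intro: ideal_ideal_residual)
    show "?IJ <+>\<^bsub>R\<^esub> ?JI = carrier R"
    proof (rule ccontr)
      assume "?IJ <+>\<^bsub>R\<^esub> ?JI \<noteq> carrier R"
      then obtain M where M: "maximalideal M R" "?IJ <+>\<^bsub>R\<^esub> ?JI \<subseteq> M"
        using ideal_subset_maximalideal add_ideals[OF IJ JI] by blast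
      \<comment> \<open>The sum of two ideals is generated by their union, so it contains
        both.\<close>
      have sub: "?IJ \<subseteq> M" "?JI \<subseteq> M"
        using M(2) union_genideal[OF IJ JI] genideal_self[of "?IJ \<union> ?JI"]
        by (auto simp: ideal_residual_def)
      interpret mult_subset R "carrier R - M"
        using assms(1) M(1) by (rule mult_subset_maximalideal)
      let ?E = "\<lambda>K. {frac a s | a s. a \<in> K \<and> s \<in> carrier R - M}"
      have "?E I \<subseteq> ?E J \<or> ?E J \<subseteq> ?E I"
        using chain[OF M(1)] ideal_frac[OF I] ideal_frac[OF J]
        unfolding localization_at_def by blast
      \<comment> \<open>Either inclusion puts an element of \<open>carrier R - M\<close> into one of
        the residuals, although both lie in \<open>M\<close>.\<close>
      then show False
        using residual_meets_denominators[OF assms(2) I J]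
          residual_meets_denominators[OF assms(2) J I] sub by blast
    qed
  qed
qed

theorem theorem4p5:
  fixes R (structure)
  assumes "cring R" and "noetherian_ring R"
  shows "MTL_ring R \<longleftrightarrow>
    (\<forall>M. maximalideal M R \<longrightarrow>
      (\<forall>I J. ideal I (localization_at R M) \<longrightarrow> ideal J (localization_at R M) \<longrightarrow> I \<subseteq> J \<or> J \<subseteq> I))"
  by (intro iffI allI impI MTL_ring_if_localizations_chain[OF assms])
    (erule (3) MTL_ring.ideals_localization_chain, simp)

end
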